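(* Let $m\ge 2$, $n\ge1$, $\bar{\mathcal A}\in\mathcal T_{m,n}$ and $\bar{\mathbf q}\in{\rm int}(S_{\bar{\mathcal A}}^* )$. Suppose there exists a neighborhood $\bar{\mathcal N}$ of $\bar{\mathcal A}$ in $\mathcal T_{m,n}$ such that for every $\mathcal A\in\bar{\mathcal N}$ and every nonempty subset $\alpha\subseteq I_n$ the set ${\rm Tpos}(\mathbb R^n_+,\mathcal C_{\mathcal A}(\alpha))$ is closed. Then there exist positive scalars $\varepsilon$ and $c$ such that for all $(\mathbf q,\mathcal A)\in\mathbb R^n\times\mathcal T_{m,n}$ with $\|\mathbf q-\bar{\mathbf q}\|+\|\mathcal A-\bar{\mathcal A}\|_F\le\varepsilon$ and $\mathcal A$ copositive, the following hold: (i) ${\rm SOL}(\mathbb R^n_+,\mathbf q,\mathcal A)\ne\emptyset$; (ii) $\|\mathbf x\|\le c$ for all $\mathbf x\in{\rm SOL}(\mathbb R^n_+,\mathbf q,\mathcal A)$.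
   Context: $\mathcal T_{m,n}$ is the space of real $m$-th order $n$-dimensional tensors $\mathcal A=(a_{i_1\ldots i_m})_{1\le i_1,\ldots,i_m\le n}$, with $\|\mathcal A-\mathcal B\|_F=\big(\sum_{i_1,\ldots,i_m}(a_{i_1\ldots i_m}-b_{i_1\ldots i_m})^2\big)^{1/2}$; $I_n=\{1,\ldots,n\}$. For $\mathbf x\in\mathbb R^n$, $\mathcal A\mathbf x^{m-1}\in\mathbb R^n$ has components $(\mathcal A\mathbf x^{m-1})_i=\sum_{i_2,\ldots,i_m=1}^n a_{ii_2\ldots i_m}x_{i_2}\cdots x_{i_m}$, and $\mathcal A\mathbf x^m=\mathbf x^\top\mathcal A\mathbf x^{m-1}$. $\mathcal A$ is copositive if $\mathcal A\mathbf x^m\ge 0$ for all $\mathbf x\in\mathbb R^n_+=\{\mathbf x:\ x_i\ge0\ \forall i\}$. For a closed convex cone $K\subseteq\mathbb R^n$, $K^*=\{\mathbf y:\langle\mathbf y,\mathbf x\rangle\ge0\ \forall \mathbf x\in K\}$, and $${\rm SOL}(K,\mathbf q,\mathcal A)=\{\mathbf x\in K:\ \mathcal A\mathbf x^{m-1}+\mathbf q\in K^*,\ \langle\mathbf x,\mathcal A\mathbf x^{m-1}+\mathbf q\rangle=0\}.$$ $S_{\mathcal A}:={\rm SOL}(\mathbb R^n_+,\mathbf 0,\mathcal A)$, and $S_{\mathcal A}^*=\{\mathbf y:\langle\mathbf y,\mathbf x\rangle\ge0\ \forall\mathbf x\in S_{\mathcal A}\}$; ${\rm int}$ denotes topological interior.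 ${\rm Tpos}(K,\mathcal A):=\{\mathcal A\mathbf x^{m-1}:\mathbf x\in K\}$. For $\alpha\subseteq I_n$, the complementary tensor $\mathcal C_{\mathcal A}(\alpha)\in\mathcal T_{m,n}$ has entries $(\mathcal C_{\mathcal A}(\alpha))_{i_1\ldots i_m}=-a_{i_1\ldots i_m}$ if $i_1\in I_n$ and $i_2,\ldots,i_m\in\alpha$; $=\sigma_{i_1\ldots i_m}$ if $i_1,\ldots,i_m\notin\alpha$; and $=0$ otherwise, where $\sigma_{i_1\ldots i_m}=1$ if $i_1=\cdots=i_m$ and $0$ otherwise. *)

theory Defs
  imports "HOL-Analysis.Analysis"
begin

text \<open>
  A real tensor of order m and dimension n is a vector of entries indexed by the tuples
  (i_1, ..., i_m) of elements of I_n.  The index set I_n is the finite type 'n and the set of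
  positions 1, ..., m is the finite linearly ordered type 'm, so n = CARD('n), m = CARD('m), and
  a tuple is a function from positions to indices.  The order on 'm serves only to single out
  the first position.
\<close>

type_synonym ('m, 'n) tensor = "real ^ ('m \<Rightarrow> 'n)"

lemma norm_tensor_is_Frobenius:
  fixes A B :: "('m::finite, 'n::finite) tensor"
  shows "norm (A - B) = sqrt (\<Sum>t\<in>UNIV. (A $ t - B $ t)\<^sup>2)"
  by (simp add: norm_vec_def L2_set_def)

definition first_pos :: "'m::{finite,linorder}" where
  "first_pos = Min UNIV"

text \<open>The vector A x^(m-1): its i-th component sums over all tuples with first index i.\<close>

definition tensor_apply ::
    "('m::{finite,linorder}, 'n::finite) tensor \<Rightarrow> real ^ 'n \<Rightarrow> real ^ 'n" where
  "tensor_apply A x =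
     (\<chi> i. \<Sum>t\<in>{t. t first_pos = i}. A $ t * (\<Prod>k\<in>UNIV - {first_pos}. x $ t k))"

text \<open>The scalar A x^m.\<close>

definition tensor_form ::
    "('m::{finite,linorder}, 'n::finite) tensor \<Rightarrow> real ^ 'n \<Rightarrow> real" where
  "tensor_form A x = x \<bullet> tensor_apply A x"

definition nonneg_orthant :: "(real ^ 'n::finite) set" where
  "nonneg_orthant = {x. \<forall>i. 0 \<le> x $ i}"

definition copositive :: "('m::{finite,linorder}, 'n::finite) tensor \<Rightarrow> bool" where
  "copositive A \<longleftrightarrow> (\<forall>x\<in>nonneg_orthant. 0 \<le> tensor_form A x)"

definition dual_cone :: "(real ^ 'n::finite) set \<Rightarrow> (real ^ 'n) set" where
  "dual_cone K = {y. \<forall>x\<in>K. 0 \<le> y \<bullet> x}"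

definition SOL ::
    "(real ^ 'n::finite) set \<Rightarrow> real ^ 'n \<Rightarrow> ('m::{finite,linorder}, 'n) tensor \<Rightarrow> (real ^ 'n) set"
  where
  "SOL K q A =
     {x \<in> K. tensor_apply A x + q \<in> dual_cone K \<and> x \<bullet> (tensor_apply A x + q) = 0}"

text \<open>The set S_A, which need not be convex.\<close>

definition zero_SOL :: "('m::{finite,linorder}, 'n::finite) tensor \<Rightarrow> (real ^ 'n) set" where
  "zero_SOL A = SOL nonneg_orthant 0 A"

definition Tpos ::
    "(real ^ 'n::finite) set \<Rightarrow> ('m::{finite,linorder}, 'n) tensor \<Rightarrow> (real ^ 'n) set" where
  "Tpos K A = tensor_apply A ` K"

text \<open>For m at least 2 the first two cases exclude each other, so their order is immaterial.\<close>

definition complementary_tensor ::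
    "('m::{finite,linorder}, 'n::finite) tensor \<Rightarrow> 'n set \<Rightarrow> ('m, 'n) tensor" where
  "complementary_tensor A \<alpha> =
     (\<chi> t. if \<forall>k. k \<noteq> first_pos \<longrightarrow> t k \<in> \<alpha> then - (A $ t)
           else if \<forall>k. t k \<notin> \<alpha> then (if \<forall>k l. t k = t l then 1 else 0)
           else 0)"

end

theory Submission
  imports Defs
begin

text \<open>
  Solutions that escape to infinity leave a trace in \<^term>\<open>zero_SOL Abar\<close>.  If solutions
  \<open>x\<^sub>k\<close> of problems with copositive data \<open>(q\<^sub>k, A\<^sub>k) \<longlongrightarrow> (qbar, Abar)\<close> grow without bound, then by
  homogeneity of degree \<open>m - 1 \<ge> 1\<close> the vectors \<open>q\<^sub>k\<close> become negligible after rescaling, and a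
  limit \<open>u\<close> of the directions \<open>x\<^sub>k / \<parallel>x\<^sub>k\<parallel>\<close> is a unit vector in \<^term>\<open>zero_SOL Abar\<close>.
  Copositivity turns complementarity into \<open>x\<^sub>k \<bullet> q\<^sub>k \<le> 0\<close>, hence \<open>u \<bullet> qbar \<le> 0\<close>, whereas an
  interior point of the dual cone is strictly positive on nonzero members.

  The same argument bounds the solutions for all the vectors \<open>q + \<lambda> e\<close> with \<open>\<lambda> \<ge> 0\<close> and \<open>e\<close> the
  all-ones vector, uniformly in \<open>\<lambda>\<close> (\<open>shifted_solutions_bounded\<close>), and this stronger bound also
  yields existence.  By Brouwer's theorem the variational inequality on the truncated orthant
  \<open>{x \<ge> 0. \<Sum>x\<^sub>i \<le> R}\<close> has a solution; it solves the complementarity problem for \<open>q + \<lambda> e\<close>, where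
  \<open>\<lambda> \<ge> 0\<close> is the multiplier of the truncating constraint (\<open>truncated_solution_exists\<close>).  For
  large \<open>R\<close> the uniform bound makes that constraint inactive, so \<open>\<lambda> = 0\<close>.
\<close>

section \<open>Tensors acting on vectors\<close>

lemma tensor_apply_scaleR:
  fixes A :: "('m::{finite,linorder}, 'n::finite) tensor"
  shows "tensor_apply A (c *\<^sub>R x) = c ^ (CARD('m) - 1) *\<^sub>R tensor_apply A x"
  by (simp add: tensor_apply_def vec_eq_iff prod.distrib sum_distrib_left card_Diff_singleton
      mult.left_commute)

lemma tendsto_tensor_apply:
  fixes A :: "'a \<Rightarrow> ('m::{finite,linorder}, 'n::finite) tensor"
  assumes "(A \<longlongrightarrow> B) F" "(x \<longlongrightarrow> y) F"
  shows "((\<lambda>k. tensor_apply (A k) (x k)) \<longlongrightarrow> tensor_apply B y) F"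
  unfolding tensor_apply_def
  by (intro tendsto_vec_lambda tendsto_sum tendsto_mult tendsto_prod tendsto_vec_nth assms)

lemma continuous_on_tensor_apply: "continuous_on S (tensor_apply A)"
  unfolding continuous_on_def by (auto intro!: tendsto_tensor_apply)

section \<open>Complementarity on the nonnegative orthant\<close>

lemma inner_one: "x \<bullet> (1 :: real ^ 'n::finite) = (\<Sum>i\<in>UNIV. x $ i)"
  by (simp add: inner_vec_def)

lemma inner_nonneg_orthant:
  assumes "x \<in> nonneg_orthant" "y \<in> nonneg_orthant"
  shows "0 \<le> x \<bullet> y"
  using assms by (auto simp: nonneg_orthant_def inner_vec_def intro!: sum_nonneg)

lemma dual_cone_nonneg_orthant: "dual_cone nonneg_orthant = nonneg_orthant"
proof
  show "dual_cone nonneg_orthant \<subseteq> (nonneg_orthant :: (real ^ 'n) set)"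
  proof
    fix y :: "real ^ 'n" assume y: "y \<in> dual_cone nonneg_orthant"
    have "0 \<le> y \<bullet> axis i 1" for i
      using y by (auto simp: dual_cone_def nonneg_orthant_def axis_def)
    then show "y \<in> nonneg_orthant"
      by (simp add: nonneg_orthant_def inner_axis)
  qed
qed (auto simp: dual_cone_def intro: inner_nonneg_orthant)

lemma SOL_nonneg_orthant_iff:
  "x \<in> SOL nonneg_orthant q A \<longleftrightarrow>
     x \<in> nonneg_orthant \<and> tensor_apply A x + q \<in> nonneg_orthant \<and>
     x \<bullet> (tensor_apply A x + q) = 0"
  by (simp add: SOL_def dual_cone_nonneg_orthant)

lemma closed_nonneg_orthant: "closed (nonneg_orthant :: (real ^ 'n::finite) set)"
  unfolding nonneg_orthant_def
  by (intro closed_Collect_all closed_Collect_le continuous_intros)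

lemma nonneg_orthant_scaleR:
  "0 \<le> c \<Longrightarrow> x \<in> nonneg_orthant \<Longrightarrow> c *\<^sub>R x \<in> nonneg_orthant"
  by (simp add: nonneg_orthant_def)

lemma norm_le_sum_nonneg_orthant:
  "x \<in> nonneg_orthant \<Longrightarrow> norm x \<le> x \<bullet> 1"
  using norm_le_l1_cart[of x] by (simp add: nonneg_orthant_def inner_one)

text \<open>
  Moving from an interior point a little against \<open>u\<close> stays in the dual cone, which leaves room
  for strict positivity.
\<close>

lemma interior_dual_cone_pos:
  fixes u :: "real ^ 'n::finite"
  assumes q: "q \<in> interior (dual_cone S)" and u: "u \<in> S" "u \<noteq> 0"
  shows "0 < q \<bullet> u"
proof -
  obtain r where r: "0 < r" "cball q r \<subseteq> dual_cone S"
    using q by (meson mem_interior_cball)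
  have "q - (r / norm u) *\<^sub>R u \<in> cball q r"
    using r u by (simp add: dist_norm)
  with r have "q - (r / norm u) *\<^sub>R u \<in> dual_cone S" by blast
  with u have "0 \<le> (q - (r / norm u) *\<^sub>R u) \<bullet> u"
    unfolding dual_cone_def by blast
  moreover have "0 < (r / norm u) * (u \<bullet> u)"
    using r u by simp
  ultimately show ?thesis
    by (simp add: inner_diff_left)
qed

section \<open>A uniform bound on solutions\<close>

text \<open>
  Copositivity leaves \<open>x \<bullet> q + \<lambda> \<Sum>x\<^sub>i \<le> 0\<close> of the complementarity condition.
  As \<open>\<Sum>x\<^sub>i\<close> dominates the norm of \<open>x\<close>, this caps the shift.
\<close>

lemma copositive_shifted_solution:
  fixes A :: "('m::{finite,linorder}, 'n::finite) tensor"
  assumes A: "copositive A" and l: "0 \<le> l"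
    and x: "x \<in> SOL nonneg_orthant (q + l *\<^sub>R 1) A" and nz: "x \<noteq> 0"
  shows "x \<bullet> q \<le> 0" and "l \<le> norm q"
proof -
  have xp: "x \<in> nonneg_orthant" and 0: "x \<bullet> (tensor_apply A x + (q + l *\<^sub>R 1)) = 0"
    using x by (auto simp: SOL_nonneg_orthant_iff)
  have "0 \<le> x \<bullet> tensor_apply A x"
    using A xp by (auto simp: copositive_def tensor_form_def)
  with 0 have le: "x \<bullet> q + l * (x \<bullet> 1) \<le> 0"
    by (simp add: inner_add_right)
  have n: "norm x \<le> x \<bullet> 1"
    using xp by (rule norm_le_sum_nonneg_orthant)
  have ln: "l * norm x \<le> l * (x \<bullet> 1)"
    using l n by (simp add: mult_left_mono)
  have "0 \<le> l * norm x" using l by simp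
  with le ln show "x \<bullet> q \<le> 0" by linarith
  have "- (x \<bullet> q) \<le> norm q * norm x"
    using Cauchy_Schwarz_ineq2[of x q] by (simp add: mult.commute)
  with le ln have "l * norm x \<le> norm q * norm x" by linarith
  with nz show "l \<le> norm q" by simp
qed

text \<open>
  The passage to the limit in the directions of unbounded solutions.  The shifts have already
  been absorbed in the bounded vectors \<open>w k\<close>.
\<close>

lemma unbounded_solutions_limit_direction:
  fixes Abar :: "('m::{finite,linorder}, 'n::finite) tensor"
  assumes m: "CARD('m) \<ge> 2"
    and A: "A \<longlonglongrightarrow> Abar"
    and w: "\<And>k. norm (w k) \<le> C"
    and x: "\<And>k. x k \<in> SOL nonneg_orthant (w k) (A k)"
    and large: "\<And>k. real (Suc k) \<le> norm (x k)"
  obtains u and r :: "nat \<Rightarrow> nat"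
  where "u \<in> zero_SOL Abar" "norm u = 1" "strict_mono r"
    "(\<lambda>k. x (r k) /\<^sub>R norm (x (r k))) \<longlonglongrightarrow> u"
proof -
  define v where "v k = x k /\<^sub>R norm (x k)" for k
  define z where "z k = (inverse (norm (x k))) ^ (CARD('m) - 1)" for k
  have xnz: "x k \<noteq> 0" for k
    using large[of k] by auto
  have v1: "norm (v k) = 1" for k
    using xnz by (simp add: v_def)
  have "\<forall>k. v k \<in> sphere 0 1"
    using v1 by simp
  then obtain u r where u: "u \<in> sphere 0 1" and r: "strict_mono r" and lim: "(v \<circ> r) \<longlonglongrightarrow> u"
    using compact_sphere[of "0 :: real ^ 'n" 1] unfolding compact_def by metis
  have z0: "0 \<le> z k" for k
    by (simp add: z_def)
  have zle: "z k \<le> inverse (real (Suc k))" for k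
  proof -
    have i: "inverse (norm (x k)) \<le> inverse (real (Suc k))"
      using large[of k] by (intro le_imp_inverse_le) auto
    moreover have "inverse (real (Suc k)) \<le> 1"
      by (simp add: field_simps)
    ultimately have "inverse (norm (x k)) \<le> 1" by linarith
    then have "z k \<le> inverse (norm (x k)) ^ 1"
      unfolding z_def using m by (intro power_decreasing) auto
    with i show ?thesis by simp
  qed
  have C: "0 \<le> C"
    using w[of 0] norm_ge_zero order_trans by blast
  have bound: "norm (z k *\<^sub>R w k) \<le> inverse (real (Suc k)) * C" for k
    using mult_mono[OF zle w _ norm_ge_zero, of k k] z0 by simp
  have "(\<lambda>k. inverse (real (Suc k)) * C) \<longlonglongrightarrow> 0"
    using tendsto_mult_left_zero[OF LIMSEQ_inverse_real_of_nat, of C] by simp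
  then have "(\<lambda>k. z k *\<^sub>R w k) \<longlonglongrightarrow> 0"
    by (rule Lim_null_comparison[rotated]) (intro always_eventually allI bound)
  then have zw: "(\<lambda>k. z (r k) *\<^sub>R w (r k)) \<longlonglongrightarrow> 0"
    using LIMSEQ_subseq_LIMSEQ[OF _ r] by (force simp: o_def)
  have vr: "(\<lambda>k. v (r k)) \<longlonglongrightarrow> u"
    using lim by (simp add: o_def)
  have Ar: "(\<lambda>k. A (r k)) \<longlonglongrightarrow> Abar"
    using LIMSEQ_subseq_LIMSEQ[OF A r] by (simp add: o_def)
  define g where "g k = tensor_apply (A k) (v k) + z k *\<^sub>R w k" for k
  have g: "g k = z k *\<^sub>R (tensor_apply (A k) (x k) + w k)" for k
    by (simp add: g_def v_def z_def tensor_apply_scaleR scaleR_add_right)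
  have vpos: "v k \<in> nonneg_orthant" for k
    using x[of k] by (auto simp: v_def SOL_nonneg_orthant_iff intro!: nonneg_orthant_scaleR)
  have gpos: "g k \<in> nonneg_orthant" for k
    using x[of k] z0 by (auto simp: g SOL_nonneg_orthant_iff intro!: nonneg_orthant_scaleR)
  have vg: "v k \<bullet> g k = 0" for k
    using x[of k] by (simp add: g v_def SOL_nonneg_orthant_iff)
  have glim: "(\<lambda>k. g (r k)) \<longlonglongrightarrow> tensor_apply Abar u"
    using tendsto_add[OF tendsto_tensor_apply[OF Ar vr] zw] by (simp add: g_def)
  have "u \<in> nonneg_orthant"
    using closed_sequentially[OF closed_nonneg_orthant _ vr] vpos by blast
  moreover have "tensor_apply Abar u \<in> nonneg_orthant"
    using closed_sequentially[OF closed_nonneg_orthant _ glim] gpos by blast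
  moreover have "u \<bullet> tensor_apply Abar u = 0"
    using tendsto_inner[OF vr glim] by (simp add: vg LIMSEQ_const_iff)
  ultimately have "u \<in> zero_SOL Abar"
    by (simp add: zero_SOL_def SOL_nonneg_orthant_iff)
  with u r vr show ?thesis
    by (intro that[of u r]) (auto simp: v_def)
qed

text \<open>
  Uniformity in the shift is what makes this bound yield existence as well: it applies to a
  solution of a truncated problem before its multiplier is known to vanish.
\<close>

lemma shifted_solutions_bounded:
  fixes Abar :: "('m::{finite,linorder}, 'n::finite) tensor"
  assumes m: "CARD('m) \<ge> 2"
    and qbar: "qbar \<in> interior (dual_cone (zero_SOL Abar))"
  obtains \<epsilon> c :: real where "0 < \<epsilon>" "0 < c"
    "\<And>q A l x. norm (q - qbar) + norm (A - Abar) \<le> \<epsilon> \<Longrightarrow> copositive A \<Longrightarrow> 0 \<le> l \<Longrightarrow>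
       x \<in> SOL nonneg_orthant (q + l *\<^sub>R 1) A \<Longrightarrow> norm x \<le> c"
proof (rule ccontr)
  assume neg: "\<not> thesis"
  have "\<exists>q A l x. norm (q - qbar) + norm (A - Abar) \<le> inverse (real (Suc k)) \<and> copositive A \<and>
          0 \<le> l \<and> x \<in> SOL nonneg_orthant (q + l *\<^sub>R 1) A \<and> real (Suc k) < norm x" for k
  proof (rule ccontr)
    assume "\<not> ?thesis"
    then have "thesis"
      by (intro that[of "inverse (real (Suc k))" "real (Suc k)"]) (auto simp: not_less)
    with neg show False by blast
  qed
  then obtain q A l x where
    near: "\<And>k. norm (q k - qbar) + norm (A k - Abar) \<le> inverse (real (Suc k))" and
    cop: "\<And>k. copositive (A k)" and l: "\<And>k::nat. 0 \<le> (l k :: real)" and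
    x: "\<And>k. x k \<in> SOL nonneg_orthant (q k + l k *\<^sub>R 1) (A k)" and
    large: "\<And>k. real (Suc k) < norm (x k)"
    by metis
  have qn: "norm (q k - qbar) \<le> inverse (real (Suc k))" for k
    using near[of k] norm_ge_zero[of "A k - Abar"] by linarith
  have An: "norm (A k - Abar) \<le> inverse (real (Suc k))" for k
    using near[of k] norm_ge_zero[of "q k - qbar"] by linarith
  have qlim: "q \<longlonglongrightarrow> qbar"
    by (rule Lim_transform[OF tendsto_const Lim_null_comparison[OF _ LIMSEQ_inverse_real_of_nat]])
      (use qn in \<open>simp add: norm_minus_commute\<close>)
  have Alim: "A \<longlonglongrightarrow> Abar"
    by (rule Lim_transform[OF tendsto_const Lim_null_comparison[OF _ LIMSEQ_inverse_real_of_nat]])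
      (use An in \<open>simp add: norm_minus_commute\<close>)
  have xnz: "x k \<noteq> 0" for k
    using large[of k] by auto
  have xq: "x k \<bullet> q k \<le> 0" and lq: "l k \<le> norm (q k)" for k
    using copositive_shifted_solution[OF cop l x xnz] by auto
  define Q where "Q = norm qbar + 1"
  have qQ: "norm (q k) \<le> Q" for k
  proof -
    have "inverse (real (Suc k)) \<le> 1" by (simp add: field_simps)
    with qn[of k] norm_triangle_sub[of "q k" qbar] show ?thesis
      unfolding Q_def by linarith
  qed
  have wb: "norm (q k + l k *\<^sub>R 1) \<le> Q + Q * norm (1 :: real ^ 'n)" for k
  proof -
    have "l k \<le> Q" using lq[of k] qQ[of k] by linarith
    then have "norm (l k *\<^sub>R (1 :: real ^ 'n)) \<le> Q * norm (1 :: real ^ 'n)"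
      using l[of k] by (simp add: mult_right_mono)
    with qQ[of k] norm_triangle_ineq[of "q k" "l k *\<^sub>R 1"] show ?thesis by linarith
  qed
  obtain u r where u: "u \<in> zero_SOL Abar" "norm u = 1" and r: "strict_mono r"
    and lim: "(\<lambda>k. x (r k) /\<^sub>R norm (x (r k))) \<longlonglongrightarrow> u"
    using unbounded_solutions_limit_direction[OF m Alim wb x less_imp_le[OF large]] .
  have "(\<lambda>k. q (r k)) \<longlonglongrightarrow> qbar"
    using LIMSEQ_subseq_LIMSEQ[OF qlim r] by (simp add: o_def)
  from tendsto_inner[OF lim this] have "u \<bullet> qbar \<le> 0"
  proof (rule LIMSEQ_le_const2, intro exI allI impI)
    fix k
    show "(x (r k) /\<^sub>R norm (x (r k))) \<bullet> q (r k) \<le> 0"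
      using xq[of "r k"] by (simp add: mult_nonneg_nonpos)
  qed
  moreover have "0 < qbar \<bullet> u"
    using u by (intro interior_dual_cone_pos[OF qbar]) auto
  ultimately show False
    by (simp add: inner_commute)
qed

section \<open>Solutions by truncation\<close>

text \<open>A fixed point of \<open>x \<mapsto> proj\<^sub>K (x - F x)\<close> is the same as a solution.\<close>

lemma variational_inequality_solvable:
  fixes F :: "'a::euclidean_space \<Rightarrow> 'a"
  assumes K: "compact K" "convex K" "K \<noteq> {}" and F: "continuous_on K F"
  obtains x where "x \<in> K" "\<And>y. y \<in> K \<Longrightarrow> F x \<bullet> x \<le> F x \<bullet> y"
proof -
  have "closed K" using K by (simp add: compact_imp_closed)
  have "continuous_on K (\<lambda>x. closest_point K (x - F x))"
    by (rule continuous_on_compose2[OF continuous_on_closest_point[OF K(2) \<open>closed K\<close> K(3)]])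
      (auto intro!: continuous_intros F)
  moreover have "(\<lambda>x. closest_point K (x - F x)) \<in> K \<rightarrow> K"
    using closest_point_in_set[OF \<open>closed K\<close> K(3)] by blast
  ultimately obtain x where x: "x \<in> K" "closest_point K (x - F x) = x"
    using brouwer[OF K(1,2,3)] by blast
  have "F x \<bullet> x \<le> F x \<bullet> y" if "y \<in> K" for y
    using closest_point_dot[OF K(2) \<open>closed K\<close> that, of "x - F x"] x(2)
    by (simp add: inner_diff_right)
  with x that show ?thesis by blast
qed

text \<open>
  The value \<open>F x \<bullet> x\<close> at a solution of the variational inequality is nonpositive (compare with
  the origin) and at most \<open>R F\<^sub>i\<close> (compare with the vertices \<open>R e\<^sub>i\<close>); hence \<open>\<lambda> = - (F x \<bullet> x) / R\<close>
  is a multiplier for the constraint \<open>\<Sum>x\<^sub>i \<le> R\<close>.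
\<close>

lemma truncated_solution_exists:
  fixes A :: "('m::{finite,linorder}, 'n::finite) tensor"
  assumes R: "0 < R"
  obtains x l where "0 \<le> l" "x \<in> SOL nonneg_orthant (q + l *\<^sub>R 1) A"
    "l = 0 \<or> x \<bullet> 1 = R"
proof -
  define K :: "(real ^ 'n) set" where "K = {x \<in> nonneg_orthant. x \<bullet> 1 \<le> R}"
  define F where "F x = tensor_apply A x + q" for x
  have "closed K"
    unfolding K_def nonneg_orthant_def mem_Collect_eq
    by (intro closed_Collect_conj closed_Collect_all closed_Collect_le continuous_intros)
  moreover have "bounded K"
    using norm_le_sum_nonneg_orthant
    by (intro boundedI[of _ R]) (force simp: K_def)
  ultimately have "compact K"
    by (simp add: compact_eq_bounded_closed)
  moreover have "convex K"
    unfolding K_def nonneg_orthant_def convex_def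
    by (auto simp: inner_add_left intro!: add_nonneg_nonneg convex_bound_le)
  moreover have K0: "0 \<in> K"
    using R by (simp add: K_def nonneg_orthant_def)
  moreover have "continuous_on K F"
    unfolding F_def by (intro continuous_intros continuous_on_tensor_apply)
  ultimately obtain x where x: "x \<in> K" and vi: "\<And>y. y \<in> K \<Longrightarrow> F x \<bullet> x \<le> F x \<bullet> y"
    using variational_inequality_solvable[of K F] by blast
  define l where "l = - (F x \<bullet> x) / R"
  have v: "F x \<bullet> x \<le> 0"
    using vi[OF K0] by simp
  then have l: "0 \<le> l"
    using R by (simp add: l_def divide_nonpos_pos)
  have lR: "l * R = - (F x \<bullet> x)"
    using R by (simp add: l_def)
  have xp: "x \<in> nonneg_orthant" and xR: "x \<bullet> 1 \<le> R"
    using x by (auto simp: K_def)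
  have Fp: "F x + l *\<^sub>R 1 \<in> nonneg_orthant"
  proof -
    have "0 \<le> F x $ i + l" for i
    proof -
      have "axis i R \<in> K"
        using R by (simp add: K_def nonneg_orthant_def inner_axis') (simp add: axis_def)
      from vi[OF this] lR have "0 \<le> R * (F x $ i + l)"
        by (simp add: inner_axis algebra_simps)
      with R show ?thesis by (simp add: zero_le_mult_iff)
    qed
    then show ?thesis by (simp add: nonneg_orthant_def)
  qed
  have eq: "x \<bullet> (F x + l *\<^sub>R 1) = l * (x \<bullet> 1 - R)"
    using lR by (simp add: inner_add_right inner_commute algebra_simps)
  then have "x \<bullet> (F x + l *\<^sub>R 1) \<le> 0"
    using l xR by (simp add: mult_nonneg_nonpos)
  with inner_nonneg_orthant[OF xp Fp] have 0: "x \<bullet> (F x + l *\<^sub>R 1) = 0" by linarith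
  show ?thesis
  proof (rule that[of l x])
    show "x \<in> SOL nonneg_orthant (q + l *\<^sub>R 1) A"
      using xp Fp 0 by (simp add: SOL_nonneg_orthant_iff F_def add.assoc)
    show "l = 0 \<or> x \<bullet> 1 = R"
      using eq 0 by auto
  qed (rule l)
qed

theorem theorem4p2:
  fixes Abar :: "('m::{finite,linorder}, 'n::finite) tensor"
    and qbar :: "real ^ 'n"
  assumes "CARD('m) \<ge> 2"
    and "qbar \<in> interior (dual_cone (zero_SOL Abar))"
    and "\<exists>N. Abar \<in> interior N \<and>
           (\<forall>A\<in>N. \<forall>\<alpha>::'n set. \<alpha> \<noteq> {} \<longrightarrow>
              closed (Tpos nonneg_orthant (complementary_tensor A \<alpha>)))"
  shows "\<exists>\<epsilon>>0. \<exists>c>0. \<forall>(q :: real ^ 'n) (A :: ('m, 'n) tensor).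
           norm (q - qbar) + norm (A - Abar) \<le> \<epsilon> \<and> copositive A \<longrightarrow>
             SOL nonneg_orthant q A \<noteq> {} \<and>
             (\<forall>x\<in>SOL nonneg_orthant q A. norm x \<le> c)"
proof -
  obtain \<epsilon> c :: real where pos: "0 < \<epsilon>" "0 < c"
    and bound: "\<And>q A l x. norm (q - qbar) + norm (A - Abar) \<le> \<epsilon> \<Longrightarrow> copositive A \<Longrightarrow> 0 \<le> l \<Longrightarrow>
       x \<in> SOL nonneg_orthant (q + l *\<^sub>R 1) A \<Longrightarrow> norm x \<le> c"
    using shifted_solutions_bounded[OF assms(1,2)] by metis
  have "SOL nonneg_orthant q A \<noteq> {} \<and> (\<forall>x\<in>SOL nonneg_orthant q A. norm x \<le> c)"
    if near: "norm (q - qbar) + norm (A - Abar) \<le> \<epsilon>" and A: "copositive A"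
    for q and A :: "('m, 'n) tensor"
  proof
    \<comment> \<open>By Cauchy-Schwarz, \<open>\<Sum>x\<^sub>i\<close> stays below this radius when the norm of \<open>x\<close> is at most \<open>c\<close>.\<close>
    define R where "R = c * norm (1 :: real ^ 'n) + 1"
    have "0 < R"
      using pos by (simp add: R_def add_nonneg_pos)
    then obtain x l where l: "0 \<le> l" and x: "x \<in> SOL nonneg_orthant (q + l *\<^sub>R 1) A"
      and R: "l = 0 \<or> x \<bullet> 1 = R"
      by (rule truncated_solution_exists)
    have "x \<bullet> 1 \<le> norm x * norm (1 :: real ^ 'n)"
      by (rule norm_cauchy_schwarz)
    also have "\<dots> \<le> c * norm (1 :: real ^ 'n)"
      using bound[OF near A l x] by (simp add: mult_right_mono)
    also have "\<dots> < R" by (simp add: R_def)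
    finally have "l = 0" using R by simp
    with x show "SOL nonneg_orthant q A \<noteq> {}" by auto
    show "\<forall>x\<in>SOL nonneg_orthant q A. norm x \<le> c"
      using bound[OF near A order_refl] by simp
  qed
  with pos show ?thesis by blast
qed

end
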